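(* For an integer $n\ge 1$ and integers $x,y$, let $M_n$ be the $n\times n$ matrix all of whose diagonal entries equal $x$ and all of whose off-diagonal entries equal $y$: \[ M_n=\begin{bmatrix} x & y & y & \ldots & y\\ y & x & y & \ldots & y\\ & & \ldots & & \\ y & y & \ldots & y & x\end{bmatrix}. \] For $n\ge 3$, there are no pairs $(x,y)$ of integers with $y\neq 0$ such that $\det(M_n)=\pm 1$. *)

theory Defs
  imports "Jordan_Normal_Form.Determinant"
begin

definition xy_mat :: "nat \<Rightarrow> int \<Rightarrow> int \<Rightarrow> int mat" where
  "xy_mat n x y = mat n n (\<lambda>(i, j). if i = j then x else y)"

end

theory Submission
  imports Defs
begin

text \<open>
  The all-ones vector is an eigenvector of \<open>M\<^sub>n\<close> with eigenvalue \<open>x + (n - 1) y\<close>, and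
  \<open>e\<^sub>0 - e\<^sub>1\<close> is one with eigenvalue \<open>x - y\<close>. An integer eigenvalue of an integer matrix with an
  eigenvector having an entry 1 divides the determinant, by applying the adjugate. So if the
  determinant is a unit, both eigenvalues are \<open>\<plusminus>1\<close>; their difference \<open>n y\<close> is then at most 2 in
  absolute value, which forces \<open>y = 0\<close> for \<open>n \<ge> 3\<close>.
\<close>

lemma eigenvalue_dvd_det:
  fixes A :: "'a :: comm_ring_1 mat"
  assumes A: "A \<in> carrier_mat n n" and v: "v \<in> carrier_vec n"
    and eig: "A *\<^sub>v v = k \<cdot>\<^sub>v v" and i: "i < n" "v $ i = 1"
  shows "k dvd det A"
proof -
  note adj = adj_mat[OF A]
  have "det A \<cdot>\<^sub>v v = (adj_mat A * A) *\<^sub>v v"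
    unfolding adj(3) using v by (intro eq_vecI) auto
  also have "\<dots> = adj_mat A *\<^sub>v (k \<cdot>\<^sub>v v)"
    using assoc_mult_mat_vec[OF adj(1) A v] eig by simp
  also have "\<dots> = k \<cdot>\<^sub>v (adj_mat A *\<^sub>v v)"
    using adj(1) v by (intro eq_vecI) auto
  \<comment> \<open>Reading off the entry where \<open>v\<close> is 1 isolates \<open>det A\<close>
    without any division.\<close>
  finally have "(det A \<cdot>\<^sub>v v) $ i = (k \<cdot>\<^sub>v (adj_mat A *\<^sub>v v)) $ i" by simp
  then have "det A = k * (adj_mat A *\<^sub>v v) $ i"
    using i v adj(1) by simp
  then show ?thesis by simp
qed

lemma xy_mat_carrier [simp]: "xy_mat n x y \<in> carrier_mat n n"
  by (simp add: xy_mat_def)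

text \<open>The matrix is \<open>(x - y) I + y J\<close> with \<open>J\<close> all ones, and
  \<open>J\<close> sends \<open>v\<close> to its entry sum in every coordinate.\<close>

lemma xy_mat_mult_vec_index:
  assumes "v \<in> carrier_vec n" "i < n"
  shows "(xy_mat n x y *\<^sub>v v) $ i = (x - y) * v $ i + y * (\<Sum>j<n. v $ j)"
proof -
  have "(xy_mat n x y *\<^sub>v v) $ i = (\<Sum>j<n. (if i = j then x else y) * v $ j)"
    using assms by (simp add: xy_mat_def scalar_prod_def lessThan_atLeast0)
  also have "\<dots> = (\<Sum>j<n. (if i = j then (x - y) * v $ j else 0) + y * v $ j)"
    by (intro sum.cong) (auto simp: algebra_simps)
  also have "\<dots> = (x - y) * v $ i + y * (\<Sum>j<n. v $ j)"
    using assms by (simp add: sum.distrib sum_distrib_left)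
  finally show ?thesis .
qed

lemma row_sum_dvd_det_xy_mat:
  assumes "n \<ge> 1"
  shows "x - y + int n * y dvd det (xy_mat n x y)"
proof (rule eigenvalue_dvd_det)
  let ?v = "vec n (\<lambda>_. 1) :: int vec"
  show "xy_mat n x y *\<^sub>v ?v = (x - y + int n * y) \<cdot>\<^sub>v ?v"
  proof (rule eq_vecI)
    fix i assume "i < dim_vec ((x - y + int n * y) \<cdot>\<^sub>v ?v)"
    then show "(xy_mat n x y *\<^sub>v ?v) $ i = ((x - y + int n * y) \<cdot>\<^sub>v ?v) $ i"
      by (simp add: xy_mat_mult_vec_index)
  qed (simp add: xy_mat_def)
  show "0 < n" "?v $ 0 = 1" using assms by auto
qed auto

lemma diff_dvd_det_xy_mat:
  assumes "n \<ge> 2"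
  shows "x - y dvd det (xy_mat n x y)"
proof (rule eigenvalue_dvd_det)
  let ?v = "vec n (\<lambda>j. (if j = 0 then 1 else 0) - (if j = 1 then 1 else 0)) :: int vec"
  \<comment> \<open>As \<open>n \<ge> 2\<close>, both nonzero entries 1 and -1 lie in range and
    cancel, so the \<open>y J\<close> part kills \<open>?v\<close>.\<close>
  have "(\<Sum>j<n. ?v $ j) = 0"
    using assms by (simp add: sum_subtractf)
  then show "xy_mat n x y *\<^sub>v ?v = (x - y) \<cdot>\<^sub>v ?v"
    \<comment> \<open>Without \<open>index_vec\<close>, the sum keeps the shape of the fact just
      proved.\<close>
    by (intro eq_vecI) (simp_all add: xy_mat_mult_vec_index del: index_vec, simp_all add: xy_mat_def)
  show "?v $ 0 = 1" using assms by simp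
qed (use assms in auto)

theorem proposition4:
  fixes n :: nat
  assumes "n \<ge> 3"
  shows "\<not> (\<exists>x y :: int. y \<noteq> 0 \<and> (det (xy_mat n x y) = 1 \<or> det (xy_mat n x y) = -1))"
proof
  assume "\<exists>x y :: int. y \<noteq> 0 \<and> (det (xy_mat n x y) = 1 \<or> det (xy_mat n x y) = -1)"
  then obtain x y :: int where y: "y \<noteq> 0"
    and "det (xy_mat n x y) = 1 \<or> det (xy_mat n x y) = -1" by blast
  then have unit: "det (xy_mat n x y) dvd 1" by auto
  have "x - y dvd 1" "x - y + int n * y dvd 1"
    using assms dvd_trans[OF diff_dvd_det_xy_mat unit] dvd_trans[OF row_sum_dvd_det_xy_mat unit]
    by auto
  then have "\<bar>x - y\<bar> = 1" "\<bar>x - y + int n * y\<bar> = 1" by simp_all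
  then have "\<bar>int n * y\<bar> \<le> 2" by linarith
  \<comment> \<open>The factor 1 bounds \<open>\<bar>y\<bar>\<close> from below, \<open>y\<close>
    being a nonzero integer.\<close>
  moreover have "3 * 1 \<le> int n * \<bar>y\<bar>"
    using assms y by (intro mult_mono) auto
  ultimately show False by (simp add: abs_mult)
qed

end
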